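(* In $\mathbb{S}^{2\times 2}$ every full-dimensional maximal outer-product-free set is either the cone of positive semidefinite matrices or a halfspace of the form $\{X\in\mathbb{S}^{2\times 2}:\langle A,X\rangle \geq 0\}$, where $A$ is a symmetric negative semidefinite matrix.
   Context: $\mathbb{S}^{2\times 2}$ is the space of real symmetric $2\times 2$ matrices with the matrix (trace) inner product $\langle\cdot,\cdot\rangle$. Let $S_{OP}:=\{X\in\mathbb{S}^{2\times 2}: X=xx^T,\ x\in\mathbb{R}^{2}\}$. A set $C\subseteq\mathbb{S}^{2\times 2}$ is outer-product-free if it is closed and convex and $\mathrm{int}(C)\cap S_{OP}=\emptyset$. An outer-product-free set is maximal if it is not strictly contained in any other outer-product-free set. *)

theory Defs
  imports "HOL-Analysis.Analysis"
begin

definition sym_mats :: "(real^2^2) set" where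
  "sym_mats = {X. transpose X = X}"

text \<open>The inner product of \<^typ>\<open>real^2^2\<close> is the trace inner product, and hence its
  topology restricted to \<^const>\<open>sym_mats\<close> is the one of the Euclidean space
  of symmetric matrices.\<close>

lemma inner_eq_trace: "A \<bullet> X = trace (transpose A ** X)" for A X :: "real^2^2"
  by (simp add: inner_vec_def trace_def matrix_matrix_mult_def transpose_def sum_2)

definition outer_products :: "(real^2^2) set" where
  "outer_products = {X. \<exists>x::real^2. X = (\<chi> i j. x $ i * x $ j)}"

definition psd :: "real^2^2 \<Rightarrow> bool" where
  "psd A \<longleftrightarrow> A \<in> sym_mats \<and> (\<forall>x. x \<bullet> (A *v x) \<ge> 0)"

definition nsd :: "real^2^2 \<Rightarrow> bool" where
  "nsd A \<longleftrightarrow> A \<in> sym_mats \<and> (\<forall>x. x \<bullet> (A *v x) \<le> 0)"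

text \<open>Closedness and interior are taken relative to the space of symmetric matrices;
  \<^term>\<open>interior C\<close> in \<^typ>\<open>real^2^2\<close> would be empty for every
  \<^term>\<open>C \<subseteq> sym_mats\<close>. The condition
  \<^term>\<open>closedin (top_of_set sym_mats) C\<close> includes \<^term>\<open>C \<subseteq> sym_mats\<close>.\<close>

definition outer_product_free :: "(real^2^2) set \<Rightarrow> bool" where
  "outer_product_free C \<longleftrightarrow>
     closedin (top_of_set sym_mats) C \<and> convex C \<and>
     (top_of_set sym_mats interior_of C) \<inter> outer_products = {}"

definition maximal_outer_product_free :: "(real^2^2) set \<Rightarrow> bool" where
  "maximal_outer_product_free C \<longleftrightarrow>
     outer_product_free C \<and> \<not> (\<exists>D. outer_product_free D \<and> C \<subset> D)"

definition full_dimensional :: "(real^2^2) set \<Rightarrow> bool" where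
  "full_dimensional C \<longleftrightarrow> aff_dim C = aff_dim sym_mats"

end

theory Submission
  imports Defs
begin

text \<open>
  In dimension two a positive semidefinite matrix that is not positive definite has rank at most
  one, so the outer products are exactly the boundary of the semidefinite cone in the space of
  symmetric matrices (lemma \<open>sym_mats_frontier_outer_product\<close>). The interior of a convex set is
  connected. If it avoids this boundary, it either stays inside the cone or misses the
  cone altogether; a full-dimensional closed convex set is the closure of its interior, so
  inclusions of the interior in closed sets carry over to the whole set.

  In the first case the set is contained in the semidefinite cone, which is itself
  outer-product-free (\<open>outer_product_free_psd\<close>), and maximality gives equality. In the second case a
  hyperplane separates the interior from the cone. As the cone is closed under scaling, the
  functional \<open>A\<close> is nonpositive on it, that is, \<open>A\<close> is negative semidefinite; as the cone contains
  0, the functional is nonnegative on the set (\<open>nsd_halfspace_separating_psd\<close>). The set lies in the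
  linear halfspace of \<open>A\<close>, which is outer-product-free (\<open>outer_product_free_halfspace\<close>), and
  again maximality gives equality.

  The interiors relative to the symmetric matrices are handled as relative interiors: a
  full-dimensional set of symmetric matrices has the space of all of them as its affine hull.
\<close>

section \<open>Quadratic forms of two-by-two matrices\<close>

lemma subspace_sym_mats: "subspace sym_mats"
  by (auto simp: sym_mats_def subspace_def transpose_def vec_eq_iff)

lemma sym_mats_iff: "X \<in> sym_mats \<longleftrightarrow> X $ 1 $ 2 = X $ 2 $ 1"
  by (auto simp: sym_mats_def transpose_def vec_eq_iff forall_2)

lemma quadratic_form_eq:
  fixes X :: "real^2^2"
  shows "x \<bullet> (X *v x) =
    X$1$1 * (x$1)\<^sup>2 + (X$1$2 + X$2$1) * (x$1 * x$2) + X$2$2 * (x$2)\<^sup>2"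
  by (simp add: matrix_vector_mult_def inner_vec_def sum_2 power2_eq_square algebra_simps)

lemma inner_outer_product:
  fixes A :: "real^2^2"
  shows "A \<bullet> (\<chi> i j. x $ i * x $ j) = x \<bullet> (A *v x)"
  by (simp add: matrix_vector_mult_def inner_vec_def sum_2 algebra_simps)

lemma quadratic_form_outer_product:
  fixes x y :: "real^2"
  shows "y \<bullet> ((\<chi> i j. x $ i * x $ j) *v y) = (x \<bullet> y)\<^sup>2"
  by (simp add: matrix_vector_mult_def inner_vec_def sum_2 power2_eq_square algebra_simps)

lemma closed_nonneg_quadratic_forms: "closed {X :: real^2^2. \<forall>x. x \<bullet> (X *v x) \<ge> 0}"
  unfolding quadratic_form_eq by (intro closed_Collect_all closed_Collect_le continuous_intros)

text \<open>Completing the square in the first coordinate. The hypotheses describe an open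
  set in the space of all matrices, symmetric or not, which exhibits interior points there.\<close>

lemma quadratic_form_nonneg:
  fixes X :: "real^2^2"
  assumes "X$1$1 > 0" "4 * X$1$1 * X$2$2 > (X$1$2 + X$2$1)\<^sup>2"
  shows "x \<bullet> (X *v x) \<ge> 0"
proof -
  have "4 * X$1$1 * (x \<bullet> (X *v x)) = (2 * X$1$1 * x$1 + (X$1$2 + X$2$1) * x$2)\<^sup>2
      + (4 * X$1$1 * X$2$2 - (X$1$2 + X$2$1)\<^sup>2) * (x$2)\<^sup>2"
    unfolding quadratic_form_eq by (simp add: power2_eq_square algebra_simps)
  also have "\<dots> \<ge> 0"
    using assms(2) by (intro add_nonneg_nonneg mult_nonneg_nonneg) auto
  finally show ?thesis
    using assms(1) by (simp add: zero_le_mult_iff)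
qed

lemma psd_entries:
  assumes "psd X"
  shows "X$1$1 \<ge> 0" "X$2$2 \<ge> 0" "(X$1$2)\<^sup>2 \<le> X$1$1 * X$2$2"
proof -
  have q: "X$1$1 * s\<^sup>2 + 2 * X$1$2 * (s * t) + X$2$2 * t\<^sup>2 \<ge> 0" for s t
  proof -
    have "vector [s, t] \<bullet> (X *v vector [s, t]) \<ge> 0"
      using assms unfolding psd_def by blast
    then show ?thesis
      using assms by (simp add: quadratic_form_eq psd_def sym_mats_iff)
  qed
  show a: "X$1$1 \<ge> 0" using q[of 1 0] by simp
  show d: "X$2$2 \<ge> 0" using q[of 0 1] by simp
  \<comment> \<open>At the vector \<open>(- X$1$2, X$1$1)\<close> the form is \<open>X$1$1\<close> times the determinant. This
    carries no information if \<open>X$1$1 = 0\<close>; then the form is affine along the line \<open>t = X$1$2\<close>, and a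
    sufficiently negative \<open>s\<close> forces \<open>X$1$2 = 0\<close>.\<close>
  show "(X$1$2)\<^sup>2 \<le> X$1$1 * X$2$2"
  proof (cases "X$1$1 = 0")
    case True
    have "2 * (X$1$2)\<^sup>2 * (X$2$2 + 1) \<le> X$2$2 * (X$1$2)\<^sup>2"
      using q[of "- (X$2$2 + 1)" "X$1$2"] True
      by (simp add: power2_eq_square algebra_simps)
    then have "(X$2$2 + 2) * (X$1$2)\<^sup>2 \<le> 0"
      by (simp add: algebra_simps)
    then show ?thesis
      using True d by (simp add: mult_le_0_iff)
  next
    case False
    have "X$1$1 * (X$1$1 * X$2$2 - (X$1$2)\<^sup>2) \<ge> 0"
      using q[of "- (X$1$2)" "X$1$1"] by (simp add: power2_eq_square algebra_simps)
    then show ?thesis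
      using a False by (simp add: zero_le_mult_iff)
  qed
qed

text \<open>The vector is \<open>(sqrt (X$1$1), \<plusminus> sqrt (X$2$2))\<close>, with the sign of the off-diagonal entry.\<close>

lemma singular_psd_outer_product:
  assumes "psd X" "(X$1$2)\<^sup>2 = X$1$1 * X$2$2"
  shows "X \<in> outer_products"
proof -
  note e = psd_entries[OF assms(1)]
  define s :: real where "s = (if X$1$2 \<ge> 0 then 1 else -1)"
  have "\<bar>X$1$2\<bar> = sqrt (X$1$1) * sqrt (X$2$2)"
    using assms(2) by (metis real_sqrt_abs real_sqrt_mult)
  then have o: "s * (sqrt (X$1$1) * sqrt (X$2$2)) = X$1$2" and s: "s * s = 1"
    by (auto simp: s_def)
  have "s * sqrt (X$2$2) * (s * sqrt (X$2$2)) = (s * s) * (sqrt (X$2$2) * sqrt (X$2$2))"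
    by (simp only: mult_ac)
  then have ss: "s * sqrt (X$2$2) * (s * sqrt (X$2$2)) = X$2$2"
    using s e(2) by simp
  have "X$2$1 = X$1$2" using assms(1) by (simp add: psd_def sym_mats_iff)
  then have "X = (\<chi> i j. (vector [sqrt (X$1$1), s * sqrt (X$2$2)] :: real^2) $ i
                 * (vector [sqrt (X$1$1), s * sqrt (X$2$2)] :: real^2) $ j)"
    using o ss e by (simp add: vec_eq_iff forall_2 mult_ac)
  then show ?thesis
    unfolding outer_products_def by blast
qed

text \<open>The frontier is taken in the space of all matrices, where the semidefinite cone, contained in a
  proper subspace, would be its own frontier. Dropping the symmetry condition from the cone
  leaves a set with interior points, to which a connectedness argument can be applied: at a symmetric
  positive definite \<open>X\<close> the strict inequalities on the entries persist for all nearby matrices.\<close>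

lemma sym_mats_frontier_outer_product:
  fixes X :: "real^2^2"
  assumes "X \<in> sym_mats" "X \<in> frontier {X. \<forall>x. x \<bullet> (X *v x) \<ge> 0}"
  shows "X \<in> outer_products"
proof (rule ccontr)
  let ?P = "{X :: real^2^2. \<forall>x. x \<bullet> (X *v x) \<ge> 0}"
  let ?U = "{X :: real^2^2. X$1$1 > 0 \<and> 4 * X$1$1 * X$2$2 > (X$1$2 + X$2$1)\<^sup>2}"
  assume no: "X \<notin> outer_products"
  have p: "psd X"
    using assms frontier_subset_closed[OF closed_nonneg_quadratic_forms] by (auto simp: psd_def)
  note e = psd_entries[OF p]
  have "(X$1$2)\<^sup>2 < X$1$1 * X$2$2"
    using e(3) singular_psd_outer_product[OF p] no by fastforce
  moreover from this have "X$1$1 \<noteq> 0" by auto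
  moreover have "X$2$1 = X$1$2"
    using assms(1) by (simp add: sym_mats_iff)
  ultimately have "X \<in> ?U"
    using e(1) by (simp add: power2_eq_square algebra_simps)
  moreover have "open ?U"
    by (intro open_Collect_conj open_Collect_less continuous_intros)
  moreover have "?U \<subseteq> ?P"
    using quadratic_form_nonneg by blast
  ultimately have "X \<in> interior ?P"
    by (meson interior_maximal subsetD)
  then show False
    using assms(2) by (simp add: frontier_def)
qed

section \<open>Two families of outer-product-free sets\<close>

text \<open>This reduces a proof that an outer product is not an interior point to the choice of one
  direction that leaves the set immediately.\<close>

lemma interior_of_sym_mats_step:
  assumes "Z \<in> top_of_set sym_mats interior_of S" "D \<in> sym_mats"
  obtains e :: real where "e > 0" "Z + e *\<^sub>R D \<in> S"
proof -
  obtain U where "openin (top_of_set sym_mats) U" "Z \<in> U" "U \<subseteq> S"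
    using assms(1) by (auto simp: interior_of_def)
  then obtain r where Z: "Z \<in> sym_mats" and "r > 0" and r: "ball Z r \<inter> sym_mats \<subseteq> U"
    unfolding openin_contains_ball by blast
  define e where "e = r / (2 * (norm D + 1))"
  have "e > 0"
    using \<open>r > 0\<close> by (simp add: e_def add_nonneg_pos)
  have "e * norm D < r"
    using \<open>r > 0\<close> by (simp add: e_def field_simps add_nonneg_pos add_pos_nonneg)
  then have "Z + e *\<^sub>R D \<in> ball Z r"
    using \<open>e > 0\<close> by (simp add: dist_norm)
  moreover have "Z + e *\<^sub>R D \<in> sym_mats"
    using Z assms(2) subspace_sym_mats by (simp add: subspace_add subspace_scale)
  ultimately show ?thesis
    using that[OF \<open>e > 0\<close>] r \<open>U \<subseteq> S\<close> by blast
qed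

lemma psd_imp_sym_mats: "psd X \<Longrightarrow> X \<in> sym_mats"
  by (simp add: psd_def)

lemma closed_convex_psd: "closed {X. psd X}" "convex {X. psd X}"
proof -
  have q: "{X. psd X} = sym_mats \<inter> {X. \<forall>x. x \<bullet> (X *v x) \<ge> 0}"
    by (auto simp: psd_def)
  show "closed {X. psd X}"
    unfolding q
    by (intro closed_Int closed_subspace subspace_sym_mats closed_nonneg_quadratic_forms)
  show "convex {X. psd X}"
    unfolding q
    by (intro convex_Int subspace_imp_convex[OF subspace_sym_mats])
      (auto simp: convex_def inner_right_distrib matrix_vector_mult_add_rdistrib
        scaleR_matrix_vector_assoc[symmetric])
qed

text \<open>Subtracting a small multiple of the identity from \<open>x x\<^sup>T\<close> makes the form negative on the
  vectors orthogonal to \<open>x\<close>. Dimension at least two provides such a vector.\<close>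

lemma outer_product_free_psd: "outer_product_free {X. psd X}"
proof -
  have False if Z: "Z \<in> top_of_set sym_mats interior_of {X. psd X}" "Z \<in> outer_products" for Z
  proof -
    obtain x where x: "Z = (\<chi> i j. x $ i * x $ j)"
      using Z(2) by (auto simp: outer_products_def)
    have "- mat 1 \<in> sym_mats"
      by (simp add: sym_mats_iff mat_def)
    then obtain e where e: "e > 0" "psd (Z + e *\<^sub>R (- mat 1))"
      using interior_of_sym_mats_step[OF Z(1)] by blast
    obtain y :: "real^2" where y: "y \<noteq> 0" "x \<bullet> y = 0"
    proof (cases "x = 0")
      case True
      then show ?thesis using that[of "axis 1 1"] by (simp add: axis_eq_0_iff)
    next
      case False
      then show ?thesis
        using that[of "vector [- x$2, x$1]"]
        by (auto simp: vec_eq_iff forall_2 inner_vec_def sum_2)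
    qed
    have "y \<bullet> ((Z + e *\<^sub>R (- mat 1)) *v y) = - e * (y \<bullet> y)"
      using y(2) quadratic_form_outer_product[of y x]
      by (simp add: x matrix_vector_mult_diff_rdistrib inner_diff_right
          scaleR_matrix_vector_assoc[symmetric])
    then show False
      using e y(1) by (auto simp: psd_def) (metis inner_gt_zero_iff mult_pos_pos neg_less_0_iff_less not_le)
  qed
  then show ?thesis
    unfolding outer_product_free_def using closed_convex_psd
    by (intro conjI closed_subset) (auto intro: psd_imp_sym_mats)
qed

text \<open>Since \<open>A \<bullet> x x\<^sup>T = x \<bullet> A x \<le> 0\<close>, the halfspace meets the outer products only in its bounding
  hyperplane, from which the direction \<open>- A\<close> leads out.\<close>

lemma outer_product_free_halfspace:
  assumes "nsd A" "A \<noteq> 0"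
  shows "outer_product_free {X \<in> sym_mats. A \<bullet> X \<ge> 0}"
proof -
  let ?H = "{X \<in> sym_mats. A \<bullet> X \<ge> 0}"
  have q: "?H = sym_mats \<inter> {X. A \<bullet> X \<ge> 0}"
    by auto
  have "closed ?H" "convex ?H"
    unfolding q
    by (intro closed_Int closed_subspace convex_Int subspace_imp_convex subspace_sym_mats
        closed_halfspace_ge convex_halfspace_ge)+
  moreover have False if Z: "Z \<in> top_of_set sym_mats interior_of ?H" "Z \<in> outer_products" for Z
  proof -
    have "- A \<in> sym_mats"
      using assms(1) by (simp add: nsd_def sym_mats_iff)
    then obtain e where e: "e > 0" "A \<bullet> (Z + e *\<^sub>R (- A)) \<ge> 0"
      using interior_of_sym_mats_step[OF Z(1)] by blast
    have "A \<bullet> Z \<le> 0"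
      using Z(2) assms(1) by (auto simp: outer_products_def inner_outer_product nsd_def)
    moreover have "e * (A \<bullet> A) > 0"
      using e(1) assms(2) by simp
    ultimately show False
      using e(2) by (simp add: inner_diff_right)
  qed
  ultimately show ?thesis
    unfolding outer_product_free_def by (auto intro: closed_subset)
qed

section \<open>Sets that miss the semidefinite cone\<close>

text \<open>Separating 0 from the differences \<open>X - Y\<close> amounts to separating \<open>K\<close> from the cone. The separating
  functional has to be nonzero on the symmetric matrices: a skew-symmetric matrix separates
  any two sets of symmetric matrices in the trivial way. Hence the form of
  the separation theorem is used that finds the normal vector inside the affine hull of the data.\<close>

lemma nsd_halfspace_separating_psd:
  assumes "convex K" "K \<noteq> {}" "K \<subseteq> sym_mats" "K \<inter> {X. psd X} = {}"
  obtains A where "nsd A" "A \<noteq> 0" "\<And>X. X \<in> K \<Longrightarrow> A \<bullet> X \<ge> 0"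
proof -
  let ?D = "\<Union>X\<in>K. \<Union>Y\<in>{X. psd X}. {X - Y}"
  have psd0: "psd 0"
    by (simp add: psd_def sym_mats_iff)
  have "convex ?D"
    using convex_differences[OF assms(1) closed_convex_psd(2)] .
  moreover have "?D \<noteq> {}" "0 \<notin> ?D"
    using assms psd0 by auto
  ultimately obtain A b where A: "0 + A \<in> affine hull (insert 0 ?D)" "A \<noteq> 0" "A \<bullet> 0 \<le> b"
      and sep: "\<And>X. X \<in> ?D \<Longrightarrow> A \<bullet> X \<ge> b"
    by (rule separating_hyperplane_set_point_inaff) (rule that)
  have "insert 0 ?D \<subseteq> sym_mats"
    using assms(3) subspace_sym_mats by (auto simp: psd_def subspace_0 subspace_diff)
  then have "affine hull (insert 0 ?D) \<subseteq> sym_mats"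
    by (intro hull_minimal subspace_imp_affine subspace_sym_mats)
  then have "A \<in> sym_mats"
    using subsetD[OF _ A(1)] by simp
  have ge: "A \<bullet> Y \<le> A \<bullet> X" if "X \<in> K" "psd Y" for X Y
  proof -
    have "b \<le> A \<bullet> (X - Y)"
      using that by (intro sep) blast
    then show ?thesis
      using A(3) by (simp add: inner_diff_right)
  qed
  have "x \<bullet> (A *v x) \<le> 0" for x
  proof (rule ccontr)
    assume "\<not> x \<bullet> (A *v x) \<le> 0"
    then have pos: "x \<bullet> (A *v x) > 0" by simp
    obtain X where "X \<in> K" using assms(2) by blast
    \<comment> \<open>The scaling for which \<open>A\<close> takes the value \<open>\<bar>A \<bullet> X\<bar> + 1\<close> at the outer product of \<open>r *\<^sub>R x\<close>.\<close>
    define r where "r = sqrt ((\<bar>A \<bullet> X\<bar> + 1) / (x \<bullet> (A *v x)))"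
    have "psd (\<chi> i j. (r *\<^sub>R x) $ i * (r *\<^sub>R x) $ j)"
      unfolding psd_def using quadratic_form_outer_product[of _ "r *\<^sub>R x"]
      by (simp add: sym_mats_iff)
    then have "(r *\<^sub>R x) \<bullet> (A *v (r *\<^sub>R x)) \<le> A \<bullet> X"
      using ge[OF \<open>X \<in> K\<close>] inner_outer_product by metis
    moreover have "(r *\<^sub>R x) \<bullet> (A *v (r *\<^sub>R x)) = r\<^sup>2 * (x \<bullet> (A *v x))"
      by (simp add: matrix_vector_mult_scaleR power2_eq_square)
    moreover have "r\<^sup>2 * (x \<bullet> (A *v x)) = \<bar>A \<bullet> X\<bar> + 1"
      using pos by (simp add: r_def)
    ultimately show False by linarith
  qed
  then have "nsd A"
    using \<open>A \<in> sym_mats\<close> by (simp add: nsd_def)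
  moreover have "A \<bullet> X \<ge> 0" if "X \<in> K" for X
    using ge[OF that psd0] by simp
  ultimately show ?thesis
    using that A(2) by blast
qed

section \<open>Classification\<close>

lemma full_dimensional_rel_interior:
  assumes "C \<subseteq> sym_mats" "full_dimensional C"
  shows "rel_interior C = top_of_set sym_mats interior_of C" "C \<noteq> {}"
proof -
  have d: "aff_dim C = aff_dim sym_mats"
    using assms(2) by (simp add: full_dimensional_def)
  have "affine sym_mats"
    using subspace_imp_affine subspace_sym_mats by blast
  then have "affine hull C = sym_mats"
    using assms(1) d aff_dim_eq_full_gen[of C sym_mats] by (metis hull_same)
  then show "rel_interior C = top_of_set sym_mats interior_of C"
    by (simp add: rel_interior_def interior_of_def)
  show "C \<noteq> {}"
    using d subspace_0[OF subspace_sym_mats] aff_dim_empty by (metis empty_iff)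
qed

theorem theorem27:
  fixes C :: "(real^2^2) set"
  assumes "maximal_outer_product_free C"
    and "full_dimensional C"
  shows "C = {X. psd X} \<or>
    (\<exists>A. nsd A \<and> A \<noteq> 0 \<and> C = {X \<in> sym_mats. A \<bullet> X \<ge> 0})"
proof -
  have C: "outer_product_free C"
    and max: "\<And>D. outer_product_free D \<Longrightarrow> C \<subseteq> D \<Longrightarrow> C = D"
    using assms(1) by (auto simp: maximal_outer_product_free_def)
  have cl: "closedin (top_of_set sym_mats) C" and "convex C"
    using C by (auto simp: outer_product_free_def)
  have sub: "C \<subseteq> sym_mats" and "closed C"
    using closedin_imp_subset[OF cl] closedin_closed_trans[OF cl closed_subspace[OF subspace_sym_mats]]
    by auto
  let ?R = "rel_interior C"
  let ?P = "{X :: real^2^2. \<forall>x. x \<bullet> (X *v x) \<ge> 0}"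
  note fd = full_dimensional_rel_interior[OF sub assms(2)]
  have free: "?R \<inter> outer_products = {}"
    using C fd(1) by (simp add: outer_product_free_def)
  have R: "convex ?R" "?R \<noteq> {}" "?R \<subseteq> sym_mats"
    using \<open>convex C\<close> fd(2) sub rel_interior_subset
    by (auto simp: convex_rel_interior rel_interior_eq_empty)
  have C_least: "C \<subseteq> S" if "closed S" "?R \<subseteq> S" for S
    using convex_closure_rel_interior[OF \<open>convex C\<close>] closure_minimal[OF that(2,1)]
      closure_subset by blast
  have "?R \<inter> frontier ?P = {}"
    using sym_mats_frontier_outer_product R(3) free by blast
  then consider "?R \<subseteq> ?P" | "?R \<inter> ?P = {}"
    using connected_Int_frontier[OF convex_connected[OF R(1)], of ?P] by blast
  then show ?thesis
  proof cases
    case 1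
    then have "C \<subseteq> {X. psd X}"
      using R(3) by (intro C_least closed_convex_psd) (auto simp: psd_def)
    then show ?thesis
      using max[OF outer_product_free_psd] by simp
  next
    case 2
    then have "?R \<inter> {X. psd X} = {}"
      by (auto simp: psd_def)
    then obtain A where A: "nsd A" "A \<noteq> 0" "\<And>X. X \<in> ?R \<Longrightarrow> A \<bullet> X \<ge> 0"
      using nsd_halfspace_separating_psd[OF R] by metis
    have "C \<subseteq> {X. A \<bullet> X \<ge> 0}"
      using A(3) by (intro C_least closed_halfspace_ge) auto
    then have "C = {X \<in> sym_mats. A \<bullet> X \<ge> 0}"
      using sub by (intro max outer_product_free_halfspace A) auto
    then show ?thesis
      using A by blast
  qed
qed

end
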